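(* Let $a, c, p, \theta \in \mathbb{C}$ with $c \notin \{0,-1,-2,\dots\}$. Then for all $z\in\mathbb{C}$ with $|z| < \frac{1}{|\theta|}$ and $|\arg(1-\theta z)|<\pi$, $$(1 - \theta z)^p M(a; c; z) = \sum_{n=0}^{\infty} u_n z^n,$$ where $u_0 = 1$, $u_1 = \frac{a}{c} - \theta p$, $u_2 = \frac{1}{2} \left( \frac{a^2+a}{c^2+c} - \frac{2a\theta p}{c} + \theta^2(p-1)p \right)$ and, for all $n\ge 2$, $$u_{n+1} = \beta_0(n)u_n + \beta_1(n)u_{n-1} + \beta_2(n)u_{n-2},$$ with \begin{align*} \beta_0(n) &= \frac{a + 2\theta n(c+n-1) - \theta p(c+2n) + n}{(n+1)(c+n)}, \\ \beta_1(n) &= \frac{\theta\left(-2a - \theta(n-p-1)(c+n-p-2) - 2n + p + 2\right)}{(n+1)(c+n)}, \\ \beta_2(n) &= \frac{\theta^2(a+n-p-2)}{(n+1)(c+n)}. \end{align*}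
   Context: The confluent hypergeometric function is $M(a;c;z)=\sum_{n=0}^\infty \frac{(a)_n}{(c)_n}\frac{z^n}{n!}$, where $(a)_0=1$ and $(a)_n=a(a+1)\cdots(a+n-1)$ for $n\ge1$. The power $(1-\theta z)^p$ is the principal branch. When $\theta=0$, $1/|\theta|$ is read as $+\infty$. *)

theory Defs
  imports "HOL-Analysis.Analysis"
begin

definition kummer_M :: "complex \<Rightarrow> complex \<Rightarrow> complex \<Rightarrow> complex" where
  "kummer_M a c z = (\<Sum>n. pochhammer a n / pochhammer c n * (z ^ n / fact n))"

definition beta0 :: "complex \<Rightarrow> complex \<Rightarrow> complex \<Rightarrow> complex \<Rightarrow> nat \<Rightarrow> complex" where
  "beta0 a c p \<theta> n =
     (a + 2 * \<theta> * of_nat n * (c + of_nat n - 1) - \<theta> * p * (c + 2 * of_nat n) + of_nat n)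
       / ((of_nat n + 1) * (c + of_nat n))"

definition beta1 :: "complex \<Rightarrow> complex \<Rightarrow> complex \<Rightarrow> complex \<Rightarrow> nat \<Rightarrow> complex" where
  "beta1 a c p \<theta> n =
     \<theta> * (- 2 * a - \<theta> * (of_nat n - p - 1) * (c + of_nat n - p - 2) - 2 * of_nat n + p + 2)
       / ((of_nat n + 1) * (c + of_nat n))"

definition beta2 :: "complex \<Rightarrow> complex \<Rightarrow> complex \<Rightarrow> complex \<Rightarrow> nat \<Rightarrow> complex" where
  "beta2 a c p \<theta> n =
     \<theta>\<^sup>2 * (a + of_nat n - p - 2) / ((of_nat n + 1) * (c + of_nat n))"

end

theory Submission
  imports Defs "HOL-Computational_Algebra.Formal_Power_Series"
begin

text \<open>
  Write \<open>P\<close> for the binomial series of \<open>(1 - \<theta> z)\<^sup>p\<close>, \<open>M\<close> for the Kummer series, \<open>D = 1 - \<theta> X\<close>, and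
  \<open>F = P M\<close>. The two factors satisfy linear differential equations with polynomial coefficients,
  \<open>D P' = - \<theta> p P\<close> and \<open>X M'' + (c - X) M' - a M = 0\<close>. The first of them makes multiplication by
  \<open>P\<close> intertwine differentiation with the operator \<open>f \<mapsto> f' + \<theta> p f / D\<close>, so Kummer's equation for
  \<open>M\<close> turns into a second order equation for \<open>F\<close>. Multiplying by \<open>D\<^sup>2\<close> clears the denominators; since
  \<open>D\<^sup>2\<close> has degree two, the equation couples the coefficient of index \<open>n + 1\<close> to the three
  before it, and dividing by its factor \<open>(n + 1) (c + n)\<close>, nonzero by the hypothesis on \<open>c\<close>, gives
  exactly the recurrence with \<open>\<beta>\<^sub>0\<close>, \<open>\<beta>\<^sub>1\<close>, \<open>\<beta>\<^sub>2\<close> (lemmas \<open>product_ode\<close> and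
  \<open>product_recurrence\<close>). As \<open>u\<close> has the same first three terms, \<open>u n\<close> is the coefficient of
  \<open>F\<close> for every \<open>n\<close>.

  This algebra takes place in the ring of formal power series. Analysis enters only at the end
  (lemma \<open>product_sums\<close>): both series converge absolutely for \<open>\<bar>\<theta> z\<bar> < 1\<close>, so their Cauchy product,
  whose terms are those of \<open>F\<close>, sums to the product of the two functions.
\<close>

section \<open>The two factors as formal power series\<close>

text \<open>Both analysis and formal power series use the dollar sign for an index; here it denotes a
  coefficient of a series.\<close>

unbundle no vec_syntax and fps_syntax

definition kummer_fps :: "complex \<Rightarrow> complex \<Rightarrow> complex fps" where
  "kummer_fps a c = Abs_fps (\<lambda>n. pochhammer a n / (pochhammer c n * fact n))"

definition power_fps :: "complex \<Rightarrow> complex \<Rightarrow> complex fps" where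
  "power_fps \<theta> p = Abs_fps (\<lambda>n. (p gchoose n) * (- \<theta>) ^ n)"

lemma plus_of_nat_neq_0:
  assumes "(c::complex) \<notin> \<int>\<^sub>\<le>\<^sub>0"
  shows "c + of_nat n \<noteq> 0"
  using assms plus_of_nat_eq_0_imp by blast

lemma pochhammer_neq_0:
  assumes "(c::complex) \<notin> \<int>\<^sub>\<le>\<^sub>0"
  shows "pochhammer c n \<noteq> 0"
  using assms by (auto simp: pochhammer_eq_0_iff)

text \<open>This two-term recurrence is Kummer's differential equation read off coefficient by coefficient,
  and it is also what the ratio test needs.\<close>

lemma kummer_fps_nth_Suc:
  assumes "c \<notin> \<int>\<^sub>\<le>\<^sub>0"
  shows "(of_nat n + 1) * (c + of_nat n) * kummer_fps a c $ Suc n = (a + of_nat n) * kummer_fps a c $ n"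
proof -
  have "c + of_nat n \<noteq> 0" "pochhammer c n \<noteq> 0" "(of_nat n + 1 :: complex) \<noteq> 0"
    using plus_of_nat_neq_0[OF assms] pochhammer_neq_0[OF assms] of_nat_neq_0[of n, where 'a=complex]
    by (auto simp: add.commute[of 1])
  then show ?thesis
    by (simp add: kummer_fps_def pochhammer_Suc add.commute[of 1] divide_simps)
qed

lemma kummer_fps_ode:
  fixes a c :: complex
  assumes "c \<notin> \<int>\<^sub>\<le>\<^sub>0"
  defines "M \<equiv> kummer_fps a c"
  shows "fps_X * fps_deriv (fps_deriv M) + (fps_const c - fps_X) * fps_deriv M - fps_const a * M = 0"
proof (rule fps_ext)
  fix n
  have "(of_nat n + 1) * (c + of_nat n) * M $ Suc n = (a + of_nat n) * M $ n"
    unfolding M_def by (rule kummer_fps_nth_Suc[OF assms(1)])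
  then show "(fps_X * fps_deriv (fps_deriv M) + (fps_const c - fps_X) * fps_deriv M - fps_const a * M) $ n = 0 $ n"
    by (cases n) (auto simp: algebra_simps)
qed

text \<open>Coefficientwise this is the absorption identity
  \<open>p (p gchoose n) = n (p gchoose n) + (n + 1) (p gchoose (n + 1))\<close>.\<close>

lemma power_fps_ode:
  "(1 - fps_const \<theta> * fps_X) * fps_deriv (power_fps \<theta> p) = - fps_const \<theta> * fps_const p * power_fps \<theta> p"
proof (rule fps_ext)
  fix n
  have "p * (p gchoose n) * (- \<theta>) ^ Suc n =
      (of_nat n * (p gchoose n) + of_nat (Suc n) * (p gchoose Suc n)) * (- \<theta>) ^ Suc n"
    by (simp only: gbinomial_mult_1)
  then show "((1 - fps_const \<theta> * fps_X) * fps_deriv (power_fps \<theta> p)) $ n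
      = (- fps_const \<theta> * fps_const p * power_fps \<theta> p) $ n"
    by (cases n) (auto simp: power_fps_def algebra_simps)
qed

section \<open>The differential equation and the recurrence of the product\<close>

text \<open>
  Kummer's equation multiplied by \<open>D\<^sup>2 P\<close>. The two bracketed expressions equal \<open>D\<^sup>2 P M''\<close> and
  \<open>D\<^sup>2 P M'\<close>, rewritten in terms of \<open>F\<close> and its derivatives by means of the equation for \<open>P\<close>.
\<close>

lemma product_ode:
  fixes a c p \<theta> :: complex
  assumes "c \<notin> \<int>\<^sub>\<le>\<^sub>0"
  defines "F \<equiv> power_fps \<theta> p * kummer_fps a c" and "D \<equiv> 1 - fps_const \<theta> * fps_X"
  shows "fps_X * (D ^ 2 * fps_deriv (fps_deriv F) + 2 * fps_const (\<theta> * p) * D * fps_deriv F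
            + fps_const (\<theta>\<^sup>2 * p * (p + 1)) * F)
         + (fps_const c - fps_X) * (D ^ 2 * fps_deriv F + fps_const (\<theta> * p) * D * F)
         - fps_const a * D ^ 2 * F = 0"
proof -
  define P where "P = power_fps \<theta> p"
  define M where "M = kummer_fps a c"
  define P' where "P' = fps_deriv P"
  define P'' where "P'' = fps_deriv P'"
  define M' where "M' = fps_deriv M"
  define M'' where "M'' = fps_deriv M'"
  define t where "t = fps_const \<theta>"
  define q where "q = fps_const p"
  have P1: "D * P' = - t * q * P"
    unfolding D_def P'_def P_def t_def q_def by (rule power_fps_ode)
  have derivs: "fps_deriv D = - t" "fps_deriv t = 0" "fps_deriv q = 0"
      "fps_deriv P = P'" "fps_deriv P' = P''"
    by (simp_all add: D_def t_def q_def P'_def P''_def)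
  from arg_cong[OF P1, of fps_deriv] have P2: "D * P'' = t * P' - t * q * P'"
    by (simp add: derivs algebra_simps)
  \<comment> \<open>Differentiating the equation for \<open>P\<close> gives \<open>D\<^sup>2 P''\<close> as a multiple of \<open>P\<close>.\<close>
  have DDP: "D ^ 2 * P'' = t ^ 2 * q * (q - 1) * P"
    using P1 P2 by algebra
  have M0: "fps_X * M'' + (fps_const c - fps_X) * M' - fps_const a * M = 0"
    unfolding M''_def M'_def M_def by (rule kummer_fps_ode[OF assms(1)])
  have F0: "F = P * M" by (simp add: F_def P_def M_def)
  have F1: "fps_deriv F = P' * M + P * M'" by (simp add: F0 P'_def M'_def)
  have F2: "fps_deriv (fps_deriv F) = P'' * M + 2 * P' * M' + P * M''"
    by (simp add: F1 P''_def M''_def P'_def[symmetric] M'_def[symmetric] algebra_simps)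
  have A1: "D ^ 2 * fps_deriv F + t * q * D * F = D ^ 2 * P * M'"
    unfolding F1 unfolding F0 using P1 by algebra
  have A2: "D ^ 2 * fps_deriv (fps_deriv F) + 2 * (t * q) * D * fps_deriv F + t ^ 2 * q * (q + 1) * F
      = D ^ 2 * P * M''"
    unfolding F2 unfolding F1 unfolding F0 using P1 DDP by algebra
  have coeffs: "fps_const (\<theta> * p) = t * q" "fps_const (\<theta>\<^sup>2 * p * (p + 1)) = t ^ 2 * q * (q + 1)"
    by (simp_all add: t_def q_def fps_const_power)
  show ?thesis
    unfolding coeffs A1 A2 using M0 F0 by algebra
qed

text \<open>This is the coefficient of \<open>X\<^sup>n\<close> in the differential equation. The bound \<open>n \<ge> 2\<close> keeps
  every index in range, where the subtractions on natural numbers are the true ones.\<close>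

lemma product_recurrence:
  fixes a c p \<theta> :: complex
  assumes "c \<notin> \<int>\<^sub>\<le>\<^sub>0" and "n \<ge> 2"
  defines "F \<equiv> power_fps \<theta> p * kummer_fps a c"
  shows "F $ (n + 1) = beta0 a c p \<theta> n * F $ n + beta1 a c p \<theta> n * F $ (n - 1)
             + beta2 a c p \<theta> n * F $ (n - 2)"
proof -
  obtain m where n: "n = Suc (Suc m)"
    using \<open>n \<ge> 2\<close> by (metis add_2_eq_Suc le_Suc_ex)
  define F' where "F' = fps_deriv F"
  \<comment> \<open>The series \<open>G = X F'\<close> and \<open>H = X F''\<close> have coefficients given by one formula at every index, zero
     included. With them the equation shifts indices by at most two, so that no case
     distinction on \<open>n - 2\<close> is needed.\<close>
  define G where "G = fps_X * F'"
  define H where "H = fps_X * fps_deriv F'"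
  define k where "k = (fps_const :: complex \<Rightarrow> _)"
  have G_nth: "G $ i = of_nat i * F $ i" for i
    by (cases i) (auto simp: G_def F'_def)
  have H_nth: "H $ i = of_nat i * (of_nat i + 1) * F $ (i + 1)" for i
    by (cases i) (auto simp: H_def F'_def algebra_simps)
  have "k c * F' + H + k (2 * \<theta> * p - 2 * \<theta> * c - 1) * G + k (\<theta> * p * c - a) * F
      + fps_X * (k (\<theta>\<^sup>2 * c - 2 * \<theta>\<^sup>2 * p + 2 * \<theta>) * G - k (2 * \<theta>) * H
          + k (\<theta>\<^sup>2 * p * (p + 1) - \<theta>\<^sup>2 * p * c - \<theta> * p + 2 * a * \<theta>) * F)
      + fps_X * (fps_X * (k (\<theta>\<^sup>2) * (H - G) + k (\<theta>\<^sup>2 * p - a * \<theta>\<^sup>2) * F)) = 0" (is "?ode = 0")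
    using product_ode[OF assms(1), where \<theta> = \<theta> and p = p and a = a]
    unfolding F_def[symmetric] F'_def[symmetric] G_def H_def k_def
    by (simp add: fps_const_add[symmetric] fps_const_sub[symmetric] fps_const_mult[symmetric]
        fps_const_power[symmetric] numeral_fps_const[symmetric] algebra_simps power2_eq_square
        del: fps_const_add fps_const_sub fps_const_mult fps_const_power)
  then have "?ode $ n = 0" by simp
  then have eq: "(of_nat n + 1) * (c + of_nat n) * F $ (n + 1) =
      (a + 2 * \<theta> * of_nat n * (c + of_nat n - 1) - \<theta> * p * (c + 2 * of_nat n) + of_nat n) * F $ n
      + \<theta> * (- 2 * a - \<theta> * (of_nat n - p - 1) * (c + of_nat n - p - 2) - 2 * of_nat n + p + 2) * F $ (n - 1)
      + \<theta>\<^sup>2 * (a + of_nat n - p - 2) * F $ (n - 2)"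
    by (simp add: n k_def F'_def G_nth H_nth) algebra
  have "(of_nat n + 1) * (c + of_nat n) \<noteq> 0"
    using plus_of_nat_neq_0[OF assms(1), of n] of_nat_neq_0[of n, where 'a=complex]
    by (simp add: add.commute)
  then have "F $ (n + 1) = (of_nat n + 1) * (c + of_nat n) * F $ (n + 1) / ((of_nat n + 1) * (c + of_nat n))"
    by simp
  then show ?thesis
    unfolding eq beta0_def beta1_def beta2_def
    by (simp only: times_divide_eq_left add_divide_distrib[symmetric])
qed

section \<open>Convergence\<close>

text \<open>The quotient of consecutive terms is \<open>(a + n) z / ((n + 1) (c + n))\<close>, which tends to zero; the
  Kummer series therefore converges absolutely on the whole plane.\<close>

lemma summable_kummer_fps:
  assumes "c \<notin> \<int>\<^sub>\<le>\<^sub>0"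
  shows "summable (\<lambda>n. norm (kummer_fps a c $ n * z ^ n))"
proof -
  have "((\<lambda>n. norm ((a + of_nat n) * z / ((of_nat n + 1) * (c + of_nat n)))) \<longlongrightarrow> 0) sequentially"
  proof -
    have "(\<lambda>n. (a / of_nat n + 1) * (z / of_nat (Suc n)) / (c / of_nat n + 1)) \<longlonglongrightarrow> (0 + 1) * 0 / (0 + 1)"
      by (intro tendsto_intros lim_const_over_n LIMSEQ_Suc[OF lim_const_over_n]) auto
    moreover have "(a / of_nat n + 1) * (z / of_nat (Suc n)) / (c / of_nat n + 1)
        = (a + of_nat n) * z / ((of_nat n + 1) * (c + of_nat n))" if "n > 0" for n
    proof -
      have "a / of_nat n + 1 = (a + of_nat n) / of_nat n" "c / of_nat n + 1 = (c + of_nat n) / of_nat n"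
        using that by (simp_all add: field_simps)
      then show ?thesis using that by (simp add: ac_simps)
    qed
    then have "eventually (\<lambda>n. (a / of_nat n + 1) * (z / of_nat (Suc n)) / (c / of_nat n + 1)
        = (a + of_nat n) * z / ((of_nat n + 1) * (c + of_nat n))) sequentially"
      using eventually_gt_at_top[of 0] by (rule eventually_mono[rotated])
    ultimately have "(\<lambda>n. (a + of_nat n) * z / ((of_nat n + 1) * (c + of_nat n))) \<longlonglongrightarrow> 0"
      by (auto dest: Lim_transform_eventually)
    then show ?thesis
      by (rule tendsto_norm_zero)
  qed
  then have "eventually (\<lambda>n. norm ((a + of_nat n) * z / ((of_nat n + 1) * (c + of_nat n))) < 1 / 2) sequentially"
    by (rule order_tendstoD) simp
  then obtain N where N: "\<And>n. n \<ge> N \<Longrightarrow> norm ((a + of_nat n) * z / ((of_nat n + 1) * (c + of_nat n))) < 1 / 2"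
    by (auto simp: eventually_sequentially)
  show ?thesis
  proof (rule summable_ratio_test)
    fix n assume "n \<ge> N"
    have nz: "(of_nat n + 1) * (c + of_nat n) \<noteq> 0"
      using plus_of_nat_neq_0[OF assms(1), of n] of_nat_neq_0[of n, where 'a=complex]
      by (simp add: add.commute)
    have "kummer_fps a c $ Suc n = (a + of_nat n) / ((of_nat n + 1) * (c + of_nat n)) * kummer_fps a c $ n"
      using kummer_fps_nth_Suc[OF assms, of n a] nz by (simp add: field_simps)
    then have "kummer_fps a c $ Suc n * z ^ Suc n =
       (a + of_nat n) * z / ((of_nat n + 1) * (c + of_nat n)) * (kummer_fps a c $ n * z ^ n)"
      by simp
    then have "norm (kummer_fps a c $ Suc n * z ^ Suc n) =
       norm ((a + of_nat n) * z / ((of_nat n + 1) * (c + of_nat n))) * norm (kummer_fps a c $ n * z ^ n)"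
      by (simp only: norm_mult)
    also have "\<dots> \<le> 1 / 2 * norm (kummer_fps a c $ n * z ^ n)"
      using N[OF \<open>n \<ge> N\<close>] by (intro mult_right_mono) auto
    finally show "norm (norm (kummer_fps a c $ Suc n * z ^ Suc n)) \<le> 1 / 2 * norm (norm (kummer_fps a c $ n * z ^ n))"
      by simp
  qed simp
qed

lemma power_fps_sums:
  assumes "norm (\<theta> * z) < 1"
  shows "(\<lambda>n. power_fps \<theta> p $ n * z ^ n) sums ((1 - \<theta> * z) powr p)"
  using gen_binomial_complex[of "- \<theta> * z" p] assms
  by (simp add: power_fps_def power_mult_distrib mult.assoc norm_mult flip: power_mult_distrib)

text \<open>A power series that converges at a point converges absolutely at every point closer to the
  centre: compare with a radius \<open>r\<close> strictly between \<open>\<bar>\<theta> z\<bar>\<close> and \<open>1\<close>.\<close>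

lemma summable_power_fps:
  assumes "norm (\<theta> * z) < 1"
  shows "summable (\<lambda>n. norm (power_fps \<theta> p $ n * z ^ n))"
proof -
  obtain r where r: "norm (\<theta> * z) < r" "r < 1"
    using assms dense by blast
  then have "0 \<le> r" by (meson norm_ge_zero order_trans less_imp_le)
  have "summable (\<lambda>n. (p gchoose n) * (of_real r) ^ n)"
    using gen_binomial_complex[of "of_real r" p] r \<open>0 \<le> r\<close> by (auto simp: sums_iff)
  then have "summable (\<lambda>n. norm ((p gchoose n) * (- \<theta> * z) ^ n))"
    by (rule powser_insidea) (use r \<open>0 \<le> r\<close> in simp)
  then show ?thesis
    by (simp add: power_fps_def mult.assoc flip: power_mult_distrib)
qed

lemma product_sums:
  assumes "c \<notin> \<int>\<^sub>\<le>\<^sub>0" and "norm (\<theta> * z) < 1"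
  shows "(\<lambda>n. (power_fps \<theta> p * kummer_fps a c) $ n * z ^ n) sums ((1 - \<theta> * z) powr p * kummer_M a c z)"
proof -
  have "kummer_M a c z = (\<Sum>n. kummer_fps a c $ n * z ^ n)"
    by (simp add: kummer_M_def kummer_fps_def)
  moreover have "(1 - \<theta> * z) powr p = (\<Sum>n. power_fps \<theta> p $ n * z ^ n)"
    using power_fps_sums[OF assms(2)] by (simp add: sums_iff)
  moreover have "(\<Sum>i\<le>n. power_fps \<theta> p $ i * z ^ i * (kummer_fps a c $ (n - i) * z ^ (n - i)))
      = (power_fps \<theta> p * kummer_fps a c) $ n * z ^ n" for n
    unfolding fps_mult_nth atMost_atLeast0 sum_distrib_right
    by (intro sum.cong refl) (simp add: mult_ac flip: power_add)
  ultimately show ?thesis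
    using Cauchy_product_sums[OF summable_power_fps[OF assms(2), of p] summable_kummer_fps[OF assms(1), of a z]]
    by simp
qed

section \<open>The expansion\<close>

theorem theorem2p1:
  fixes a c p \<theta> z :: complex and u :: "nat \<Rightarrow> complex"
  assumes "c \<notin> \<int>\<^sub>\<le>\<^sub>0"
    and "u 0 = 1"
    and "u 1 = a / c - \<theta> * p"
    and "u 2 = 1 / 2 * ((a\<^sup>2 + a) / (c\<^sup>2 + c) - 2 * a * \<theta> * p / c + \<theta>\<^sup>2 * (p - 1) * p)"
    and "\<And>n. n \<ge> 2 \<Longrightarrow>
           u (n + 1) = beta0 a c p \<theta> n * u n + beta1 a c p \<theta> n * u (n - 1)
             + beta2 a c p \<theta> n * u (n - 2)"
    and "\<theta> \<noteq> 0 \<Longrightarrow> norm z < 1 / norm \<theta>"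
    and "\<bar>Arg (1 - \<theta> * z)\<bar> < pi"
  shows "(\<lambda>n. u n * z ^ n) sums ((1 - \<theta> * z) powr p * kummer_M a c z)"
proof -
  define F where "F = power_fps \<theta> p * kummer_fps a c"
  have "u n = F $ n" for n
  proof (induction n rule: less_induct)
    case (less n)
    consider "n = 0" | "n = 1" | "n = 2" | m where "n = m + 1" "m \<ge> 2"
      by (metis Suc_eq_plus1 less_2_cases not_less not0_implies_Suc numeral_2_eq_2 One_nat_def)
    then show ?case
    proof cases
      case 1
      then show ?thesis by (simp add: assms(2) F_def power_fps_def kummer_fps_def)
    next
      case 2
      then show ?thesis using assms(3)
        by (simp add: F_def power_fps_def kummer_fps_def fps_mult_nth)
    next
      case 3
      have "{0..2::nat} = {0, 1, 2}" by auto
      then have "F $ 2 = pochhammer a 2 / (pochhammer c 2 * 2) - \<theta> * p * a / c + (p gchoose 2) * \<theta>\<^sup>2"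
        by (simp add: F_def power_fps_def kummer_fps_def fps_mult_nth)
      moreover have "pochhammer a 2 = a\<^sup>2 + a" "pochhammer c 2 = c\<^sup>2 + c"
        by (simp_all add: numeral_2_eq_2 pochhammer_Suc algebra_simps)
      moreover have "p gchoose 2 = p * (p - 1) / 2"
        by (simp add: gbinomial_prod_rev numeral_2_eq_2)
      ultimately show ?thesis using assms(4) 3 by (simp add: ring_distribs add_divide_distrib diff_divide_distrib mult_ac)
    next
      case 4
      then show ?thesis
        using assms(5)[of m] product_recurrence[OF assms(1), of m \<theta> p a] less[of m] less[of "m - 1"] less[of "m - 2"]
        by (simp add: F_def)
    qed
  qed
  \<comment> \<open>For \<open>\<theta> = 0\<close> the bound is trivial, in accordance with reading \<open>1 / \<bar>\<theta>\<bar>\<close> as infinity.\<close>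
  moreover have "norm (\<theta> * z) < 1"
    using assms(6) by (cases "\<theta> = 0") (auto simp: norm_mult field_simps)
  ultimately show ?thesis
    using product_sums[OF assms(1), of \<theta> z p a] by (simp add: F_def)
qed

end
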